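(* Let $A$ be an abstract pseudogroup. There exist a set $X$ and an injective pseudogroup homomorphism $A \hookrightarrow \mathcal{I}(X)$ (i.e. $A$ admits a faithful representation by partial bijections on a set) if and only if the frame of idempotents $E(A)$ has enough points.
   Context: An inverse semigroup is a set $A$ with an associative binary operation $(a,b)\mapsto ab$ such that every $a\in A$ has a unique $a^{-1}\in A$ with $aa^{-1}a=a$ and $a^{-1}aa^{-1}=a^{-1}$. $E(A)\subseteq A$ is the set of idempotents. The natural order on $A$ is: $a\leqslant b$ iff $a=be$ for some $e\in E(A)$. A subset $S\subseteq A$ is jointly compatible if for all $a,b\in S$ both $ab^{-1}$ and $a^{-1}b$ are idempotent. $A$ is an abstract pseudogroup if every jointly compatible subset $S\subseteq A$ (including $\emptyset$) has a join $\bigvee S$ in the natural order, and $a(\bigvee S)=\bigvee_{s\in S} as$, $(\bigvee S)a=\bigvee_{s\in S} sa$ for all $a\in A$. A pseudogroup has a zero $0=\bigvee\emptyset$, a unit $1=\bigvee E(A)$, and all binary meets in the natural order; $E(A)$ with the restricted order is a frame whose binary meet is the product. A pseudogroup homomorphism is a function between pseudogroups preserving multiplication, the unit, all joins (of jointly compatible subsets) and all binary meets in the natural order. For a set $X$, $\mathcal{I}(X)$ is the pseudogroup of partial bijections of $X$ (bijections between subsets of $X$) with multiplication $fg=f\circ g$ (composition as relations, defined wherever it makes sense); its natural order is inclusion of graphs, meets are intersections of graphs, and joins of jointly compatible subsets are unions of graphs. A frame is a complete lattice in which $a\wedge\bigvee_I b_i=\bigvee_I (a\wedge b_i)$. A frame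 has enough points (is spatial) if it is isomorphic to the lattice $\mathcal{O}(Z)$ of open subsets of some topological space $Z$. *)

theory Defs
  imports "HOL-Algebra.Lattice" "HOL-Analysis.Abstract_Topology"
begin

section \<open>Inverse semigroups and abstract pseudogroups\<close>

record 'a magma = "'a partial_object" +
  mul :: "'a \<Rightarrow> 'a \<Rightarrow> 'a"  (infixl \<open>\<cdot>\<index>\<close> 70)

locale inverse_semigroup =
  fixes A :: "'a magma" (structure)
  assumes mul_closed: "\<lbrakk>a \<in> carrier A; b \<in> carrier A\<rbrakk> \<Longrightarrow> a \<cdot> b \<in> carrier A"
    and mul_assoc: "\<lbrakk>a \<in> carrier A; b \<in> carrier A; c \<in> carrier A\<rbrakk>
      \<Longrightarrow> (a \<cdot> b) \<cdot> c = a \<cdot> (b \<cdot> c)"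
    and ex1_inverse: "a \<in> carrier A
      \<Longrightarrow> \<exists>!b. b \<in> carrier A \<and> a \<cdot> b \<cdot> a = a \<and> b \<cdot> a \<cdot> b = b"

definition inverse_of :: "'a magma \<Rightarrow> 'a \<Rightarrow> 'a" where
  "inverse_of A a =
    (THE b. b \<in> carrier A \<and> a \<cdot>\<^bsub>A\<^esub> b \<cdot>\<^bsub>A\<^esub> a = a \<and> b \<cdot>\<^bsub>A\<^esub> a \<cdot>\<^bsub>A\<^esub> b = b)"

definition idempotents :: "'a magma \<Rightarrow> 'a set" where
  "idempotents A = {e \<in> carrier A. e \<cdot>\<^bsub>A\<^esub> e = e}"

definition natural_order :: "'a magma \<Rightarrow> 'a gorder" where
  "natural_order A =
    \<lparr>carrier = carrier A, eq = (=), le = (\<lambda>a b. \<exists>e\<in>idempotents A. a = b \<cdot>\<^bsub>A\<^esub> e)\<rparr>"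

definition idempotent_order :: "'a magma \<Rightarrow> 'a gorder" where
  "idempotent_order A =
    \<lparr>carrier = idempotents A, eq = (=), le = le (natural_order A)\<rparr>"

definition jointly_compatible :: "'a magma \<Rightarrow> 'a set \<Rightarrow> bool" where
  "jointly_compatible A S \<longleftrightarrow> S \<subseteq> carrier A \<and>
    (\<forall>a\<in>S. \<forall>b\<in>S. a \<cdot>\<^bsub>A\<^esub> inverse_of A b \<in> idempotents A \<and>
                   inverse_of A a \<cdot>\<^bsub>A\<^esub> b \<in> idempotents A)"

text \<open>
  The library's \<open>\<Squnion>\<close> and \<open>\<sqinter>\<close> are choice operators that return an arbitrary element if
  no join or meet exists. Existence of \<open>\<Squnion>S\<close> is therefore a separate axiom below. In the
  distributive laws the translates of \<open>S\<close> are again jointly compatible, so the joins on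
  the right-hand sides exist as well; binary meets exist because \<open>a \<sqinter> b\<close> is the join of
  the common lower bounds of \<open>a\<close> and \<open>b\<close>, which are jointly compatible.
\<close>

locale pseudogroup = inverse_semigroup +
  assumes ex_join: "jointly_compatible A S
      \<Longrightarrow> \<exists>j. least (natural_order A) j (Upper (natural_order A) S)"
    and mul_join_left: "\<lbrakk>jointly_compatible A S; a \<in> carrier A\<rbrakk>
      \<Longrightarrow> a \<cdot> (\<Squnion>\<^bsub>natural_order A\<^esub> S) = \<Squnion>\<^bsub>natural_order A\<^esub> ((\<lambda>s. a \<cdot> s) ` S)"
    and mul_join_right: "\<lbrakk>jointly_compatible A S; a \<in> carrier A\<rbrakk>
      \<Longrightarrow> (\<Squnion>\<^bsub>natural_order A\<^esub> S) \<cdot> a = \<Squnion>\<^bsub>natural_order A\<^esub> ((\<lambda>s. s \<cdot> a) ` S)"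

definition unit_of :: "'a magma \<Rightarrow> 'a" where
  "unit_of A = \<Squnion>\<^bsub>natural_order A\<^esub> (idempotents A)"

locale pseudogroup_hom = A: pseudogroup A + B: pseudogroup B
  for A :: "'a magma" and B :: "'b magma" +
  fixes \<phi> :: "'a \<Rightarrow> 'b"
  assumes hom_closed: "a \<in> carrier A \<Longrightarrow> \<phi> a \<in> carrier B"
    and hom_mul: "\<lbrakk>a \<in> carrier A; b \<in> carrier A\<rbrakk> \<Longrightarrow> \<phi> (a \<cdot>\<^bsub>A\<^esub> b) = \<phi> a \<cdot>\<^bsub>B\<^esub> \<phi> b"
    and hom_unit: "\<phi> (unit_of A) = unit_of B"
    and hom_join: "jointly_compatible A S
      \<Longrightarrow> \<phi> (\<Squnion>\<^bsub>natural_order A\<^esub> S) = \<Squnion>\<^bsub>natural_order B\<^esub> (\<phi> ` S)"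
    and hom_meet: "\<lbrakk>a \<in> carrier A; b \<in> carrier A\<rbrakk>
      \<Longrightarrow> \<phi> (a \<sqinter>\<^bsub>natural_order A\<^esub> b) = \<phi> a \<sqinter>\<^bsub>natural_order B\<^esub> \<phi> b"


section \<open>Partial bijections\<close>

text \<open>
  A partial bijection is identified with its graph, consisting of the pairs \<open>(x, f x)\<close>.
  Since \<open>O\<close> composes relations from left to right, the product \<open>f \<circ> g\<close> is \<open>g O f\<close>.
\<close>

definition partial_bijections :: "'x set \<Rightarrow> ('x \<times> 'x) set magma" where
  "partial_bijections X =
    \<lparr>carrier = {f. f \<subseteq> X \<times> X \<and> single_valued f \<and> single_valued (f\<inverse>)},
     mul = (\<lambda>f g. g O f)\<rparr>"


section \<open>Spatial frames\<close>

definition opens :: "'z topology \<Rightarrow> 'z set gorder" where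
  "opens Z = \<lparr>carrier = {U. openin Z U}, eq = (=), le = (\<subseteq>)\<rparr>"

definition order_iso ::
  "('a, 'c) gorder_scheme \<Rightarrow> ('b, 'd) gorder_scheme \<Rightarrow> ('a \<Rightarrow> 'b) \<Rightarrow> bool" where
  "order_iso L M f \<longleftrightarrow> bij_betw f (carrier L) (carrier M) \<and> order_emb L M f"

text \<open>
  HOL cannot quantify over all types inside a formula, so the type containing the points
  of the space is a parameter. An isomorphism with \<open>opens Z\<close> forces \<open>L\<close> to be a frame.
\<close>

definition has_enough_points :: "'z itself \<Rightarrow> 'a gorder \<Rightarrow> bool" where
  "has_enough_points (_ :: 'z itself) L \<longleftrightarrow>
    (\<exists>(Z :: 'z topology) f. order_iso L (opens Z) f)"

end

theory Submission
  imports Defs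
begin

text \<open>
  A representation by partial bijections of \<open>X\<close> sends idempotents to subidentities, so every
  \<open>x \<in> X\<close> gives a completely prime filter of idempotents, namely those whose image is defined at
  \<open>x\<close>; if the representation is faithful, these filters separate the idempotents.

  Conversely, if the completely prime filters separate the idempotents, let \<open>A\<close> act by left
  multiplication on germs: the germ of \<open>a\<close> at a filter \<open>p\<close> with \<open>a\<^sup>\<star>a \<in> p\<close> is the class
  of \<open>a\<close> under agreement on some idempotent in \<open>p\<close>. The mere action on the points \<open>p\<close> would
  not be faithful (it forgets a group altogether), but an idempotent \<open>e\<close> is defined at its own
  germ at \<open>p\<close> iff \<open>e \<in> p\<close>, so the action on germs is injective on idempotents, and then
  injective because it preserves meets.
\<close>

section \<open>Idempotents and inverses in an inverse semigroup\<close>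

context inverse_semigroup
begin

abbreviation inverse_elem (\<open>_\<^sup>\<star>\<close> [1000] 1000) where "a\<^sup>\<star> \<equiv> inverse_of A a"
abbreviation E where "E \<equiv> idempotents A"
abbreviation below (infix \<open>\<preceq>\<close> 50) where "a \<preceq> b \<equiv> a \<sqsubseteq>\<^bsub>natural_order A\<^esub> b"
abbreviation source where "source a \<equiv> a\<^sup>\<star> \<cdot> a"

lemma inverse:
  assumes "a \<in> carrier A"
  shows inverse_closed: "a\<^sup>\<star> \<in> carrier A"
    and inverse_left: "a \<cdot> a\<^sup>\<star> \<cdot> a = a"
    and inverse_right: "a\<^sup>\<star> \<cdot> a \<cdot> a\<^sup>\<star> = a\<^sup>\<star>"
  using theI'[OF ex1_inverse[OF assms]] unfolding inverse_of_def by auto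

lemma inverse_eqI:
  assumes "a \<in> carrier A" "b \<in> carrier A" "a \<cdot> b \<cdot> a = a" "b \<cdot> a \<cdot> b = b"
  shows "a\<^sup>\<star> = b"
  using assms ex1_inverse[OF assms(1)] inverse[OF assms(1)] by blast

lemma E_carrier: "e \<in> E \<Longrightarrow> e \<in> carrier A"
  and E_idem: "e \<in> E \<Longrightarrow> e \<cdot> e = e"
  by (auto simp: idempotents_def)

lemmas closed = mul_closed inverse_closed E_carrier

lemma EI: "e \<in> carrier A \<Longrightarrow> e \<cdot> e = e \<Longrightarrow> e \<in> E"
  by (auto simp: idempotents_def)

lemma inverse_assoc:
  assumes "a \<in> carrier A"
  shows "a \<cdot> (a\<^sup>\<star> \<cdot> a) = a" "a\<^sup>\<star> \<cdot> (a \<cdot> a\<^sup>\<star>) = a\<^sup>\<star>"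
    and "b \<in> carrier A \<Longrightarrow> a \<cdot> (a\<^sup>\<star> \<cdot> (a \<cdot> b)) = a \<cdot> b"
    and "b \<in> carrier A \<Longrightarrow> a\<^sup>\<star> \<cdot> (a \<cdot> (a\<^sup>\<star> \<cdot> b)) = a\<^sup>\<star> \<cdot> b"
  using inverse[OF assms] assms by (metis mul_assoc mul_closed)+

lemma E_idem_assoc: "e \<in> E \<Longrightarrow> b \<in> carrier A \<Longrightarrow> e \<cdot> (e \<cdot> b) = e \<cdot> b"
  by (metis E_carrier E_idem mul_assoc)

lemma inverse_idem: "e \<in> E \<Longrightarrow> e\<^sup>\<star> = e"
  by (rule inverse_eqI) (auto simp: E_carrier E_idem)

lemma inverse_inverse: "a \<in> carrier A \<Longrightarrow> a\<^sup>\<star>\<^sup>\<star> = a"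
  by (rule inverse_eqI) (auto simp: inverse)

text \<open>Uniqueness of inverses forces the inverse \<open>x\<close> of \<open>e \<cdot> f\<close>
  to equal \<open>f \<cdot> (x \<cdot> e)\<close>, which makes \<open>x\<close> idempotent. An
  idempotent is its own inverse, so \<open>e \<cdot> f\<close> is \<open>x\<close>.\<close>

lemma E_mul_closed:
  assumes e: "e \<in> E" and f: "f \<in> E"
  shows "e \<cdot> f \<in> E"
proof -
  note [simp] = closed mul_assoc E_idem E_idem_assoc
  define x where "x = (e \<cdot> f)\<^sup>\<star>"
  have x: "x \<in> carrier A" using e f by (simp add: x_def)
  have ef: "e \<cdot> (f \<cdot> (x \<cdot> (e \<cdot> f))) = e \<cdot> f" "x \<cdot> (e \<cdot> (f \<cdot> x)) = x"
    using inverse[of "e \<cdot> f"] e f x by (simp_all add: x_def[symmetric])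
  have ef': "x \<cdot> (e \<cdot> (f \<cdot> (x \<cdot> b))) = x \<cdot> b" if "b \<in> carrier A" for b
    using arg_cong[OF ef(2), of "\<lambda>y. y \<cdot> b"] that e f x by simp
  have "x = f \<cdot> (x \<cdot> e)"
    unfolding x_def by (rule inverse_eqI) (use e f x ef ef' in \<open>simp_all add: x_def[symmetric]\<close>)
  then have "x \<cdot> x = x" by (metis E_carrier e ef(2) f mul_assoc mul_closed x)
  then have "x \<in> E" using x by (simp add: EI)
  then show ?thesis using e f inverse_idem inverse_inverse[of "e \<cdot> f"] by (simp add: x_def)
qed

text \<open>Both products are idempotent, so \<open>f \<cdot> e\<close> is an inverse of
  \<open>e \<cdot> f\<close>, which is also its own inverse.\<close>

lemma E_commute:
  assumes e: "e \<in> E" and f: "f \<in> E"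
  shows "e \<cdot> f = f \<cdot> e"
proof -
  note [simp] = closed mul_assoc E_idem E_idem_assoc
  have "e \<cdot> (f \<cdot> (e \<cdot> f)) = e \<cdot> f" "f \<cdot> (e \<cdot> (f \<cdot> e)) = f \<cdot> e"
    using E_idem[OF E_mul_closed[OF e f]] E_idem[OF E_mul_closed[OF f e]] e f by simp_all
  then have "(e \<cdot> f)\<^sup>\<star> = f \<cdot> e" by (intro inverse_eqI) (use e f in simp_all)
  then show ?thesis using inverse_idem[OF E_mul_closed[OF e f]] by simp
qed

lemma source_E: "a \<in> carrier A \<Longrightarrow> a\<^sup>\<star> \<cdot> a \<in> E"
  and range_E: "a \<in> carrier A \<Longrightarrow> a \<cdot> a\<^sup>\<star> \<in> E"
  by (auto intro!: EI simp: closed mul_assoc inverse_assoc)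

lemma E_commute_assoc: "e \<in> E \<Longrightarrow> f \<in> E \<Longrightarrow> b \<in> carrier A \<Longrightarrow> e \<cdot> (f \<cdot> b) = f \<cdot> (e \<cdot> b)"
  by (metis E_carrier E_commute mul_assoc)

text \<open>Holds because \<open>e\<close> commutes with \<open>a \<cdot> a\<^sup>\<star>\<close>.
  It moves an idempotent from the left of \<open>a\<close> to the right, so restricting the range is
  also a restriction in the natural order, which multiplies on the right.\<close>

lemma idem_mul_eq:
  assumes e: "e \<in> E" and a: "a \<in> carrier A"
  shows "e \<cdot> a = a \<cdot> (a\<^sup>\<star> \<cdot> (e \<cdot> a))"
proof -
  have "a \<cdot> (a\<^sup>\<star> \<cdot> (e \<cdot> a)) = (a \<cdot> a\<^sup>\<star>) \<cdot> (e \<cdot> a)" using e a by (simp add: closed mul_assoc)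
  also have "\<dots> = e \<cdot> ((a \<cdot> a\<^sup>\<star>) \<cdot> a)"
    by (rule E_commute_assoc) (use e a range_E in auto)
  finally show ?thesis using a by (simp add: inverse)
qed

lemma conj_E:
  assumes e: "e \<in> E" and a: "a \<in> carrier A"
  shows "a\<^sup>\<star> \<cdot> (e \<cdot> a) \<in> E"
proof (rule EI)
  have "e \<cdot> (a \<cdot> (a\<^sup>\<star> \<cdot> (e \<cdot> a))) = e \<cdot> a"
    using idem_mul_eq[OF e a] e a by (metis E_idem_assoc)
  then show "a\<^sup>\<star> \<cdot> (e \<cdot> a) \<cdot> (a\<^sup>\<star> \<cdot> (e \<cdot> a)) = a\<^sup>\<star> \<cdot> (e \<cdot> a)"
    using e a by (simp add: closed mul_assoc)
qed (use e a in \<open>simp add: closed\<close>)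

lemma inverse_mul:
  assumes a: "a \<in> carrier A" and b: "b \<in> carrier A"
  shows "(a \<cdot> b)\<^sup>\<star> = b\<^sup>\<star> \<cdot> a\<^sup>\<star>"
proof -
  \<comment> \<open>In both regularity identities the range of \<open>b\<close> stands next to the
    source of \<open>a\<close>; commuting them lets each be absorbed by its own factor.\<close>
  have c: "(b \<cdot> b\<^sup>\<star>) \<cdot> ((a\<^sup>\<star> \<cdot> a) \<cdot> x) = (a\<^sup>\<star> \<cdot> a) \<cdot> ((b \<cdot> b\<^sup>\<star>) \<cdot> x)" if "x \<in> carrier A" for x
    by (rule E_commute_assoc) (use a b that range_E source_E in auto)
  show ?thesis
  proof (rule inverse_eqI)
    have "a \<cdot> b \<cdot> (b\<^sup>\<star> \<cdot> a\<^sup>\<star>) \<cdot> (a \<cdot> b) = a \<cdot> ((b \<cdot> b\<^sup>\<star>) \<cdot> ((a\<^sup>\<star> \<cdot> a) \<cdot> b))"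
      using a b by (simp add: closed mul_assoc)
    also have "\<dots> = a \<cdot> b" unfolding c[OF b] using a b by (simp add: closed mul_assoc inverse_assoc)
    finally show "a \<cdot> b \<cdot> (b\<^sup>\<star> \<cdot> a\<^sup>\<star>) \<cdot> (a \<cdot> b) = a \<cdot> b" .
    have "b\<^sup>\<star> \<cdot> a\<^sup>\<star> \<cdot> (a \<cdot> b) \<cdot> (b\<^sup>\<star> \<cdot> a\<^sup>\<star>) = b\<^sup>\<star> \<cdot> ((a\<^sup>\<star> \<cdot> a) \<cdot> ((b \<cdot> b\<^sup>\<star>) \<cdot> a\<^sup>\<star>))"
      using a b by (simp add: closed mul_assoc)
    also have "\<dots> = b\<^sup>\<star> \<cdot> a\<^sup>\<star>"
      unfolding c[OF inverse_closed[OF a], symmetric] using a b by (simp add: closed mul_assoc inverse_assoc)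
    finally show "b\<^sup>\<star> \<cdot> a\<^sup>\<star> \<cdot> (a \<cdot> b) \<cdot> (b\<^sup>\<star> \<cdot> a\<^sup>\<star>) = b\<^sup>\<star> \<cdot> a\<^sup>\<star>" .
  qed (use a b in \<open>simp_all add: closed\<close>)
qed

section \<open>The natural order, joint compatibility, joins and meets\<close>

lemma below_iff: "a \<preceq> b \<longleftrightarrow> (\<exists>e\<in>E. a = b \<cdot> e)"
  by (simp add: natural_order_def)

lemma natural_order_simps [simp]:
  "carrier (natural_order A) = carrier A" "eq (natural_order A) = (=)"
  by (simp_all add: natural_order_def)

lemma belowI: "a = b \<cdot> e \<Longrightarrow> e \<in> E \<Longrightarrow> a \<preceq> b"
  by (auto simp: below_iff)

lemma below_refl: "a \<in> carrier A \<Longrightarrow> a \<preceq> a"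
  using inverse_assoc(1) source_E by (intro belowI[of _ _ "source a"]) simp_all

lemma below_trans:
  assumes "a \<preceq> b" "b \<preceq> c" "c \<in> carrier A"
  shows "a \<preceq> c"
proof -
  obtain e f where e: "e \<in> E" "a = b \<cdot> e" and f: "f \<in> E" "b = c \<cdot> f"
    using assms(1,2) unfolding below_iff by blast
  have "a = c \<cdot> (f \<cdot> e)" using e f assms(3) by (simp add: mul_assoc E_carrier)
  then show ?thesis using E_mul_closed[OF f(1) e(1)] by (rule belowI)
qed

lemma below_antisym:
  assumes "a \<preceq> b" "b \<preceq> a" "a \<in> carrier A" "b \<in> carrier A"
  shows "a = b"
proof -
  obtain e f where e: "e \<in> E" "a = b \<cdot> e" and f: "f \<in> E" "b = a \<cdot> f"
    using assms(1,2) unfolding below_iff by blast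
  have "b \<cdot> e = a \<cdot> (f \<cdot> e)" using e(1) f assms(3) by (simp add: mul_assoc closed)
  also have "\<dots> = (a \<cdot> e) \<cdot> f" using e(1) f assms(3) by (simp add: mul_assoc closed E_commute)
  also have "a \<cdot> e = a" using e assms(4) by (simp add: mul_assoc closed E_idem)
  finally show ?thesis unfolding e(2)[symmetric] f(2)[symmetric] .
qed

lemma below_mul_right:
  assumes "a \<preceq> b" "b \<in> carrier A" "c \<in> carrier A"
  shows "a \<cdot> c \<preceq> b \<cdot> c"
proof -
  obtain e where e: "e \<in> E" "a = b \<cdot> e" using assms(1) unfolding below_iff by blast
  have "a \<cdot> c = b \<cdot> (e \<cdot> c)" using e assms by (simp add: mul_assoc closed)
  also have "\<dots> = b \<cdot> c \<cdot> (c\<^sup>\<star> \<cdot> (e \<cdot> c))"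
    using e assms by (subst idem_mul_eq) (simp_all add: mul_assoc closed)
  finally show ?thesis by (rule belowI) (rule conj_E[OF e(1) assms(3)])
qed

text \<open>Below \<open>b\<close> there are only restrictions of \<open>b\<close>, and such a
  restriction is determined by its source; the last equation is what later recovers \<open>a\<close>
  from \<open>b\<close> and \<open>source a\<close>.\<close>

lemma below_source:
  assumes "a \<preceq> b" "b \<in> carrier A"
  shows "source a = source b \<cdot> source a" "b\<^sup>\<star> \<cdot> a = source a" "a = b \<cdot> source a"
proof -
  obtain e where e: "e \<in> E" "a = b \<cdot> e" using assms(1) unfolding below_iff by blast
  have s: "source a = e \<cdot> (source b \<cdot> e)"
    using e assms by (simp add: mul_assoc closed inverse_mul inverse_idem)
  have s': "source a = source b \<cdot> e"
    unfolding s using e assms by (subst E_commute_assoc) (simp_all add: closed source_E E_idem)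
  show "b\<^sup>\<star> \<cdot> a = source a" unfolding s' using e assms by (simp add: mul_assoc closed)
  show "source a = source b \<cdot> source a"
    unfolding s' using e assms by (simp add: mul_assoc closed inverse_assoc)
  show "a = b \<cdot> source a"
    unfolding s' using e assms by (simp add: mul_assoc closed inverse_assoc)
qed

lemma source_idem: "e \<in> E \<Longrightarrow> source e = e"
  by (simp add: inverse_idem E_idem)

lemma idem_mul_below:
  assumes "e \<in> E" "a \<in> carrier A"
  shows "e \<cdot> a \<preceq> a"
  using idem_mul_eq[OF assms] conj_E[OF assms] by (rule belowI)

lemma E_below_iff:
  assumes "e \<in> E" "f \<in> E"
  shows "e \<preceq> f \<longleftrightarrow> f \<cdot> e = e"
proof
  assume "e \<preceq> f"
  then show "f \<cdot> e = e" using assms by (auto simp: below_iff E_carrier E_idem_assoc)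
next
  assume "f \<cdot> e = e"
  from this[symmetric] show "e \<preceq> f" using assms(1) by (rule belowI)
qed

lemma below_carrier: "a \<preceq> b \<Longrightarrow> b \<in> carrier A \<Longrightarrow> a \<in> carrier A"
  by (auto simp: below_iff closed)

text \<open>With \<open>a = u \<cdot> e\<close> and \<open>b = u \<cdot> f\<close>, one product is a
  conjugate of \<open>e \<cdot> f\<close> and the other a product of idempotents. This supplies
  compatibility for sets of common lower bounds and for translates of compatible sets.\<close>

lemma jointly_compatible_if_bounded:
  assumes "u \<in> carrier A" "\<And>s. s \<in> S \<Longrightarrow> s \<preceq> u"
  shows "jointly_compatible A S"
  unfolding jointly_compatible_def
proof (intro conjI ballI)
  show "S \<subseteq> carrier A" using assms below_carrier by blast
  fix a b assume ab: "a \<in> S" "b \<in> S"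
  obtain e f where e: "e \<in> E" "a = u \<cdot> e" and f: "f \<in> E" "b = u \<cdot> f"
    using assms(2) ab by (meson below_iff)
  have "a \<cdot> b\<^sup>\<star> = u\<^sup>\<star>\<^sup>\<star> \<cdot> ((e \<cdot> f) \<cdot> u\<^sup>\<star>)"
    using e f assms(1) by (simp add: mul_assoc closed inverse_mul inverse_idem inverse_inverse)
  then show "a \<cdot> b\<^sup>\<star> \<in> E" using e f assms(1) by (simp add: conj_E closed E_mul_closed)
  have "a\<^sup>\<star> \<cdot> b = e \<cdot> (source u \<cdot> f)"
    using e f assms(1) by (simp add: mul_assoc closed inverse_mul inverse_idem)
  then show "a\<^sup>\<star> \<cdot> b \<in> E" using e f assms(1) by (simp add: closed E_mul_closed source_E)
qed

text \<open>A relational form of the least upper bound, free of the choice operator in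
  \<open>\<Squnion>\<close>; \<open>join_eqI\<close> converts back.\<close>

definition is_join where
  "is_join S j \<longleftrightarrow> j \<in> carrier A \<and> (\<forall>s\<in>S. s \<preceq> j) \<and> (\<forall>u\<in>carrier A. (\<forall>s\<in>S. s \<preceq> u) \<longrightarrow> j \<preceq> u)"

lemma least_Upper_iff:
  assumes "S \<subseteq> carrier A"
  shows "least (natural_order A) j (Upper (natural_order A) S) \<longleftrightarrow> is_join S j"
proof -
  have "Upper (natural_order A) S = {u \<in> carrier A. \<forall>s\<in>S. s \<preceq> u}"
    using assms unfolding Upper_def natural_order_simps by blast
  then show ?thesis by (auto simp: least_def is_join_def)
qed

lemma is_join_unique: "is_join S i \<Longrightarrow> is_join S j \<Longrightarrow> i = j"
  unfolding is_join_def by (rule below_antisym) blast+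

lemma join_eqI:
  assumes "S \<subseteq> carrier A" "is_join S j"
  shows "\<Squnion>\<^bsub>natural_order A\<^esub> S = j"
  unfolding sup_def least_Upper_iff[OF assms(1)]
  using assms(2) by (rule some_equality) (rule is_join_unique[OF _ assms(2)])

lemma meet_eqI:
  assumes "a \<in> carrier A" "b \<in> carrier A" "m \<preceq> a" "m \<preceq> b"
    and "\<And>x. x \<preceq> a \<Longrightarrow> x \<preceq> b \<Longrightarrow> x \<preceq> m"
  shows "a \<sqinter>\<^bsub>natural_order A\<^esub> b = m"
  unfolding meet_def inf_def
proof (rule some_equality)
  have m: "m \<in> carrier A" using assms(3,1) by (rule below_carrier)
  show "greatest (natural_order A) m (Lower (natural_order A) {a, b})"
    unfolding greatest_def Lower_def using assms m by auto
  fix x assume "greatest (natural_order A) x (Lower (natural_order A) {a, b})"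
  then have "x \<preceq> a" "x \<preceq> b" "m \<preceq> x" "x \<in> carrier A"
    unfolding greatest_def Lower_def using assms m by auto
  then show "x = m" using assms(5) m below_antisym by blast
qed

end

section \<open>Unit, joins, meets and completely prime filters in a pseudogroup\<close>

context pseudogroup
begin

abbreviation join (\<open>\<Or> _\<close> [900] 900) where "\<Or> S \<equiv> \<Squnion>\<^bsub>natural_order A\<^esub> S"

lemma is_join_join: "jointly_compatible A S \<Longrightarrow> is_join S (\<Or> S)"
  using ex_join[of S] least_Upper_iff[of S] join_eqI[of S] by (auto simp: jointly_compatible_def)

lemma join:
  assumes "jointly_compatible A S"
  shows join_closed: "\<Or> S \<in> carrier A"
    and join_upper: "s \<in> S \<Longrightarrow> s \<preceq> \<Or> S"
    and join_least: "u \<in> carrier A \<Longrightarrow> (\<And>s. s \<in> S \<Longrightarrow> s \<preceq> u) \<Longrightarrow> \<Or> S \<preceq> u"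
  using is_join_join[OF assms] by (auto simp: is_join_def)

lemma compatible_E: "S \<subseteq> E \<Longrightarrow> jointly_compatible A S"
  unfolding jointly_compatible_def
  by (auto simp: subset_iff inverse_idem E_mul_closed E_carrier)

lemma unit_eq: "unit_of A = \<Or> E"
  by (simp add: unit_of_def)

text \<open>Distributivity gives the join of all \<open>e \<cdot> a\<close>. These lie below
  \<open>a\<close>, and \<open>e = a \<cdot> a\<^sup>\<star>\<close> attains it.\<close>

lemma unit_mul_left:
  assumes a: "a \<in> carrier A"
  shows "unit_of A \<cdot> a = a"
proof -
  have "unit_of A \<cdot> a = \<Or> ((\<lambda>e. e \<cdot> a) ` E)"
    unfolding unit_eq by (rule mul_join_right[OF compatible_E a]) simp
  also have "\<dots> = a"
  proof (rule join_eqI)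
    show "(\<lambda>e. e \<cdot> a) ` E \<subseteq> carrier A" using a by (auto simp: closed)
    have "u = a \<cdot> a\<^sup>\<star> \<cdot> a \<Longrightarrow> u \<in> (\<lambda>e. e \<cdot> a) ` E" for u
      using range_E[OF a] by blast
    then have "a \<in> (\<lambda>e. e \<cdot> a) ` E" using a by (simp add: inverse_left)
    then show "is_join ((\<lambda>e. e \<cdot> a) ` E) a"
      unfolding is_join_def using a idem_mul_below by auto
  qed
  finally show ?thesis .
qed

lemma unit_E: "unit_of A \<in> E"
  using join_closed[OF compatible_E, of E] unit_mul_left by (simp add: EI unit_eq)

lemma below_unit: "e \<in> E \<Longrightarrow> e \<preceq> unit_of A"
  unfolding unit_eq by (rule join_upper[OF compatible_E]) simp

text \<open>The join lies below the unit, and everything below an idempotent is idempotent.\<close>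

lemma join_E:
  assumes "S \<subseteq> E"
  shows "\<Or> S \<in> E"
proof -
  have "\<Or> S \<preceq> unit_of A"
    using assms by (intro join_least[OF compatible_E]) (auto simp: unit_E E_carrier below_unit)
  then show ?thesis unfolding below_iff using unit_E E_mul_closed by auto
qed

lemma meet:
  assumes "a \<in> carrier A" "b \<in> carrier A"
  shows meet_below: "a \<sqinter>\<^bsub>natural_order A\<^esub> b \<preceq> a" "a \<sqinter>\<^bsub>natural_order A\<^esub> b \<preceq> b"
    and meet_greatest: "x \<preceq> a \<Longrightarrow> x \<preceq> b \<Longrightarrow> x \<preceq> a \<sqinter>\<^bsub>natural_order A\<^esub> b"
proof -
  define L where "L = {x. x \<preceq> a \<and> x \<preceq> b}"
  have L: "jointly_compatible A L"
    by (rule jointly_compatible_if_bounded[OF assms(1)]) (simp add: L_def)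
  have *: "\<Or> L \<preceq> a" "\<Or> L \<preceq> b" using L assms by (auto intro!: join_least simp: L_def)
  have **: "x \<preceq> \<Or> L" if "x \<preceq> a" "x \<preceq> b" for x
    using L that by (auto intro!: join_upper simp: L_def)
  have "a \<sqinter>\<^bsub>natural_order A\<^esub> b = \<Or> L" using assms * ** by (rule meet_eqI)
  then show "a \<sqinter>\<^bsub>natural_order A\<^esub> b \<preceq> a" "a \<sqinter>\<^bsub>natural_order A\<^esub> b \<preceq> b"
    "x \<preceq> a \<Longrightarrow> x \<preceq> b \<Longrightarrow> x \<preceq> a \<sqinter>\<^bsub>natural_order A\<^esub> b"
    using * ** by simp_all
qed

text \<open>With the left factor \<open>(\<Or> S)\<^sup>\<star>\<close> held fixed, distributivity
  acts on the right factor alone, and \<open>(\<Or> S)\<^sup>\<star> \<cdot> s\<close> is already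
  \<open>source s\<close>. No inverse of a join has to be computed.\<close>

lemma source_join:
  assumes "jointly_compatible A S"
  shows "source (\<Or> S) = \<Or> (source ` S)"
proof -
  have "source (\<Or> S) = \<Or> ((\<lambda>s. (\<Or> S)\<^sup>\<star> \<cdot> s) ` S)"
    by (rule mul_join_left[OF assms]) (simp add: join_closed[OF assms] closed)
  also have "(\<lambda>s. (\<Or> S)\<^sup>\<star> \<cdot> s) ` S = source ` S"
    by (rule image_cong[OF refl]) (simp add: below_source join[OF assms])
  finally show ?thesis .
qed

text \<open>Expresses the domain condition for the action of a join as a join of idempotents, the
  form to which complete primeness applies.\<close>

lemma source_join_mul:
  assumes S: "jointly_compatible A S" and a: "a \<in> carrier A"
  shows "source ((\<Or> S) \<cdot> a) = \<Or> ((\<lambda>s. source (s \<cdot> a)) ` S)"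
proof -
  have "jointly_compatible A ((\<lambda>s. s \<cdot> a) ` S)"
    by (rule jointly_compatible_if_bounded[of "(\<Or> S) \<cdot> a"])
      (use S a in \<open>auto simp: join closed intro!: below_mul_right\<close>)
  from source_join[OF this] show ?thesis
    by (simp add: mul_join_right[OF S a] image_image)
qed

text \<open>These are the points of the frame of idempotents. Taking \<open>S = {}\<close> keeps the
  zero out of \<open>p\<close>. The empty set satisfies the conditions, but it carries no germs,
  since a germ at \<open>p\<close> has its source in \<open>p\<close>.\<close>

definition completely_prime_filter where
  "completely_prime_filter p \<longleftrightarrow> p \<subseteq> E \<and> (\<forall>e\<in>p. \<forall>f\<in>E. e \<preceq> f \<longrightarrow> f \<in> p) \<and>
    (\<forall>e\<in>p. \<forall>f\<in>p. e \<cdot> f \<in> p) \<and> (\<forall>S\<subseteq>E. \<Or> S \<in> p \<longrightarrow> S \<inter> p \<noteq> {})"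

lemma completely_prime_filterD:
  assumes "completely_prime_filter p"
  shows filter_E: "e \<in> p \<Longrightarrow> e \<in> E"
    and filter_up: "e \<in> p \<Longrightarrow> e \<preceq> f \<Longrightarrow> f \<in> E \<Longrightarrow> f \<in> p"
    and filter_mul: "e \<in> p \<Longrightarrow> f \<in> p \<Longrightarrow> e \<cdot> f \<in> p"
    and filter_prime: "S \<subseteq> E \<Longrightarrow> \<Or> S \<in> p \<Longrightarrow> \<exists>s\<in>S. s \<in> p"
  using assms unfolding completely_prime_filter_def by blast+

end

section \<open>From a spatial frame to separating filters\<close>

lemma has_enough_points_separating:
  fixes A :: "'a magma" (structure)
  assumes "pseudogroup A" and "has_enough_points TYPE('z) (idempotent_order A)"
    and e: "e \<in> idempotents A" and g: "g \<in> idempotents A"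
    and eq: "\<And>p. pseudogroup.completely_prime_filter A p \<Longrightarrow> e \<in> p \<longleftrightarrow> g \<in> p"
  shows "e = g"
proof -
  interpret pseudogroup A by fact
  obtain Z :: "'z topology" and f where "order_iso (idempotent_order A) (opens Z) f"
    using assms(2) by (auto simp: has_enough_points_def)
  then have bij: "bij_betw f E {U. openin Z U}"
    and f_le: "\<And>e g. e \<in> E \<Longrightarrow> g \<in> E \<Longrightarrow> f e \<subseteq> f g \<longleftrightarrow> e \<preceq> g"
    by (auto simp: order_iso_def order_emb_def opens_def idempotent_order_def)
  have open_f: "openin Z (f e)" if "e \<in> E" for e
    using bij that by (auto simp: bij_betw_def)
  have ex_f: "\<exists>e\<in>E. U = f e" if "openin Z U" for U
    using bij that by (auto simp: bij_betw_def)
  \<comment> \<open>Only the order is known to be preserved by \<open>f\<close>. Intersections and,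
    below, unions of opens are therefore pulled back by surjectivity to an idempotent
    \<open>h\<close>, and compared with products and joins there.\<close>
  have mul_f: "f e \<inter> f g \<subseteq> f (e \<cdot> g)" if eg: "e \<in> E" "g \<in> E" for e g
  proof -
    obtain h where h: "h \<in> E" "f e \<inter> f g = f h" using ex_f open_f eg by blast
    then have "h \<preceq> e" "h \<preceq> g" using eg by (auto simp: f_le[symmetric])
    then have "h = e \<cdot> (g \<cdot> h)" using h eg by (simp add: E_below_iff)
    then have "h \<preceq> e \<cdot> g" using h eg by (metis E_carrier belowI mul_assoc)
    then show ?thesis using h eg by (simp add: f_le E_mul_closed)
  qed
  have join_f: "f (\<Or> S) \<subseteq> \<Union> (f ` S)" if S: "S \<subseteq> E" for S
  proof -
    obtain h where h: "h \<in> E" "\<Union> (f ` S) = f h"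
      using ex_f[of "\<Union> (f ` S)"] open_f S by blast
    then have "s \<preceq> h" if "s \<in> S" for s using that S by (subst f_le[symmetric]) auto
    then have "\<Or> S \<preceq> h" using h S by (intro join_least compatible_E) (auto simp: E_carrier)
    then show ?thesis using h S by (simp add: f_le join_E)
  qed
  \<comment> \<open>A point \<open>z\<close> becomes the filter of the idempotents whose open set
    contains it, so idempotents in the same filters have the same open set.\<close>
  have "completely_prime_filter {e \<in> E. z \<in> f e}" for z
    unfolding completely_prime_filter_def
  proof (intro conjI ballI allI impI)
    fix S assume "S \<subseteq> E" "\<Or> S \<in> {e \<in> E. z \<in> f e}"
    then show "S \<inter> {e \<in> E. z \<in> f e} \<noteq> {}" using join_f by blast
  qed (use f_le mul_f E_mul_closed in blast)+
  from eq[OF this] have "f e = f g" using e g by auto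
  then show ?thesis using bij e g by (auto simp: bij_betw_def inj_on_def)
qed

lemma weak_partial_order_idempotent_order:
  assumes "inverse_semigroup A"
  shows "weak_partial_order (idempotent_order A)"
proof -
  interpret inverse_semigroup A by fact
  show ?thesis
    unfolding idempotent_order_def
    by unfold_locales
      (auto simp: below_refl E_carrier intro: below_trans below_antisym)
qed

lemma weak_partial_order_opens: "weak_partial_order (opens Z)"
  unfolding opens_def by unfold_locales auto

section \<open>The pseudogroup of partial bijections\<close>

lemma partial_bijections_simps [simp]:
  "f \<in> carrier (partial_bijections X) \<longleftrightarrow> f \<subseteq> X \<times> X \<and> single_valued f \<and> single_valued (f\<inverse>)"
  "f \<cdot>\<^bsub>partial_bijections X\<^esub> g = g O f"
  by (simp_all add: partial_bijections_def)

lemma single_valued_converse_iff: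
  "single_valued (f\<inverse>) \<longleftrightarrow> (\<forall>x y z. (x, z) \<in> f \<longrightarrow> (y, z) \<in> f \<longrightarrow> x = y)"
  by (auto simp: single_valued_def)

lemma converse_subset_Times: "f \<subseteq> X \<times> X \<Longrightarrow> f\<inverse> \<subseteq> X \<times> X"
  by auto

text \<open>For \<open>(x, y)\<close> in \<open>f\<close>, a path \<open>x\<close>,
  \<open>u\<close>, \<open>v\<close>, \<open>y\<close> through \<open>f O g O f\<close> has
  \<open>u = y\<close> and \<open>v = x\<close>. Used for \<open>f\<close>, \<open>g\<close> and for
  \<open>g\<close>, \<open>f\<close>, this makes the inverse unique.\<close>

lemma converse_if_regular:
  assumes "f O g O f = f" "single_valued f" "single_valued (f\<inverse>)"
  shows "f\<inverse> \<subseteq> g"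
proof (rule subrelI)
  fix y x assume "(y, x) \<in> f\<inverse>"
  then have xy: "(x, y) \<in> f" by simp
  then obtain u v where "(x, u) \<in> f" "(u, v) \<in> g" "(v, y) \<in> f" using assms(1) by blast
  with xy assms show "(y, x) \<in> g" unfolding single_valued_def by blast
qed

lemma relcomp_converse_regular:
  assumes "single_valued f"
  shows "f O f\<inverse> O f = f"
proof (intro equalityI subrelI)
  fix x y assume "(x, y) \<in> f O f\<inverse> O f"
  then obtain u v where "(x, u) \<in> f" "(v, u) \<in> f" "(v, y) \<in> f" by blast
  with assms show "(x, y) \<in> f" using single_valuedD by metis
qed blast

lemma inverse_semigroup_partial_bijections: "inverse_semigroup (partial_bijections X)"
proof
  fix f assume f: "f \<in> carrier (partial_bijections X)"
  then have f': "f \<subseteq> X \<times> X" "single_valued f" "single_valued (f\<inverse>)" by simp_all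
  note c = relcomp_converse_regular[OF f'(2)] relcomp_converse_regular[OF f'(3), simplified]
  show "\<exists>!g. g \<in> carrier (partial_bijections X) \<and>
    f \<cdot>\<^bsub>partial_bijections X\<^esub> g \<cdot>\<^bsub>partial_bijections X\<^esub> f = f \<and>
    g \<cdot>\<^bsub>partial_bijections X\<^esub> f \<cdot>\<^bsub>partial_bijections X\<^esub> g = g"
  proof (rule ex1I[of _ "f\<inverse>"])
    show "f\<inverse> \<in> carrier (partial_bijections X) \<and>
      f \<cdot>\<^bsub>partial_bijections X\<^esub> f\<inverse> \<cdot>\<^bsub>partial_bijections X\<^esub> f = f \<and>
      f\<inverse> \<cdot>\<^bsub>partial_bijections X\<^esub> f \<cdot>\<^bsub>partial_bijections X\<^esub> f\<inverse> = f\<inverse>"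
      using f' c by (simp add: O_assoc converse_subset_Times)
    fix g assume "g \<in> carrier (partial_bijections X) \<and>
      f \<cdot>\<^bsub>partial_bijections X\<^esub> g \<cdot>\<^bsub>partial_bijections X\<^esub> f = f \<and>
      g \<cdot>\<^bsub>partial_bijections X\<^esub> f \<cdot>\<^bsub>partial_bijections X\<^esub> g = g"
    then have g: "f O g O f = f" "g O f O g = g" "single_valued g" "single_valued (g\<inverse>)"
      by (simp_all add: O_assoc)
    have "f\<inverse> \<subseteq> g" "g\<inverse> \<subseteq> f"
      using converse_if_regular[OF g(1) f'(2,3)] converse_if_regular[OF g(2-4)] .
    then show "g = f\<inverse>" by auto
  qed
next
  fix f g assume "f \<in> carrier (partial_bijections X)" "g \<in> carrier (partial_bijections X)"
  then show "f \<cdot>\<^bsub>partial_bijections X\<^esub> g \<in> carrier (partial_bijections X)"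
    by (auto simp: converse_relcomp intro: single_valued_relcomp)
qed (auto simp: O_assoc)

interpretation partial_bijections: inverse_semigroup "partial_bijections X" for X
  by (rule inverse_semigroup_partial_bijections)

lemma inverse_of_partial_bijections:
  "f \<in> carrier (partial_bijections X) \<Longrightarrow> inverse_of (partial_bijections X) f = f\<inverse>"
  using relcomp_converse_regular[of f] relcomp_converse_regular[of "f\<inverse>"]
  by (intro partial_bijections.inverse_eqI) (simp_all add: O_assoc converse_subset_Times)

text \<open>Splitting \<open>(x, y)\<close> through \<open>e O e\<close> shows that \<open>e\<close>
  fixes \<open>y\<close>, and injectivity then forces \<open>x = y\<close>.\<close>

lemma idempotents_partial_bijections:
  "idempotents (partial_bijections X) = {e. e \<subseteq> Id_on X}"
proof (intro equalityI subsetI)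
  fix e assume e: "e \<in> idempotents (partial_bijections X)"
  then have c: "e \<subseteq> X \<times> X" "single_valued e" "single_valued (e\<inverse>)" and i: "e O e = e"
    by (auto simp: idempotents_def)
  have "x = y \<and> x \<in> X" if xy: "(x, y) \<in> e" for x y
  proof -
    obtain z where z: "(x, z) \<in> e" "(z, y) \<in> e" using xy i by blast
    then have "z = y" using c xy by (auto simp: single_valued_def)
    with z xy c show ?thesis unfolding single_valued_converse_iff by blast
  qed
  then show "e \<in> {e. e \<subseteq> Id_on X}" by (auto intro!: Id_onI)
next
  fix e assume "e \<in> {e. e \<subseteq> Id_on X}"
  then have "e \<subseteq> Id_on X" by simp
  then have "e \<subseteq> X \<times> X" "e O e = e" "single_valued e" "single_valued (e\<inverse>)"
    using converse_mono[of e "Id_on X"] single_valued_subset[OF _ single_valued_Id_on, of _ X]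
    by auto
  then show "e \<in> idempotents (partial_bijections X)"
    by (simp add: idempotents_def)
qed

text \<open>The right factor of a product acts first, so an idempotent there restricts the domain;
  the witness is the identity on \<open>Domain f\<close>.\<close>

lemma partial_bijections_below_iff:
  assumes g: "g \<in> carrier (partial_bijections X)"
  shows "f \<sqsubseteq>\<^bsub>natural_order (partial_bijections X)\<^esub> g \<longleftrightarrow> f \<subseteq> g"
proof
  assume "f \<subseteq> g"
  then have "f = Id_on (Domain f) O g" "Id_on (Domain f) \<subseteq> Id_on X"
    using g unfolding partial_bijections_simps single_valued_def by blast+
  then show "f \<sqsubseteq>\<^bsub>natural_order (partial_bijections X)\<^esub> g"
    unfolding partial_bijections.below_iff idempotents_partial_bijections by auto
qed (auto simp: partial_bijections.below_iff idempotents_partial_bijections)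

lemma partial_bijections_subset:
  "f \<subseteq> g \<Longrightarrow> g \<in> carrier (partial_bijections X) \<Longrightarrow> f \<in> carrier (partial_bijections X)"
  unfolding partial_bijections_simps single_valued_def by blast

text \<open>The hypothesis is on the union rather than on compatibility of the family, since in most
  uses the union is recognised directly as a partial bijection.\<close>

lemma is_join_Union:
  assumes "\<Union> T \<in> carrier (partial_bijections X)"
  shows "T \<subseteq> carrier (partial_bijections X)" "partial_bijections.is_join X T (\<Union> T)"
proof -
  show "T \<subseteq> carrier (partial_bijections X)"
    using partial_bijections_subset assms by blast
  show "partial_bijections.is_join X T (\<Union> T)"
    unfolding partial_bijections.is_join_def
  proof (intro conjI ballI impI)
    fix t assume "t \<in> T"
    then show "t \<sqsubseteq>\<^bsub>natural_order (partial_bijections X)\<^esub> \<Union> T"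
      by (subst partial_bijections_below_iff[OF assms]) blast
  next
    fix u assume u: "u \<in> carrier (partial_bijections X)"
      "\<forall>s\<in>T. s \<sqsubseteq>\<^bsub>natural_order (partial_bijections X)\<^esub> u"
    then show "\<Union> T \<sqsubseteq>\<^bsub>natural_order (partial_bijections X)\<^esub> u"
      unfolding partial_bijections_below_iff[OF u(1)] by blast
  qed (rule assms)
qed

lemma join_partial_bijections:
  assumes "\<Union> T \<in> carrier (partial_bijections X)"
  shows "\<Squnion>\<^bsub>natural_order (partial_bijections X)\<^esub> T = \<Union> T"
  using is_join_Union[OF assms] by (rule partial_bijections.join_eqI)

text \<open>The two halves of compatibility match the two requirements:
  \<open>g\<inverse> O f \<subseteq> Id_on X\<close> says that \<open>f\<close> and \<open>g\<close>
  agree where both are defined, and \<open>g O f\<inverse> \<subseteq> Id_on X\<close> says the same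
  of their converses.\<close>

lemma Union_partial_bijections:
  assumes "jointly_compatible (partial_bijections X) T"
  shows "\<Union> T \<in> carrier (partial_bijections X)"
proof -
  have T: "f \<subseteq> X \<times> X \<and> single_valued f \<and> single_valued (f\<inverse>)" if "f \<in> T" for f
    using assms that unfolding jointly_compatible_def
    by (metis partial_bijections_simps(1) subsetD)
  have inv: "inverse_of (partial_bijections X) f = f\<inverse>" if "f \<in> T" for f
    using T[OF that] by (simp add: inverse_of_partial_bijections)
  have *: "g\<inverse> O f \<subseteq> Id_on X" "g O f\<inverse> \<subseteq> Id_on X" if "f \<in> T" "g \<in> T" for f g
  proof -
    have "inverse_of (partial_bijections X) g O f \<in> idempotents (partial_bijections X)"
      "g O inverse_of (partial_bijections X) f \<in> idempotents (partial_bijections X)"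
      using assms that by (simp_all add: jointly_compatible_def)
    then show "g\<inverse> O f \<subseteq> Id_on X" "g O f\<inverse> \<subseteq> Id_on X"
      by (simp_all add: inv that idempotents_partial_bijections)
  qed
  have "single_valued (\<Union> T)" unfolding single_valued_def using *(1) by blast
  moreover have "single_valued ((\<Union> T)\<inverse>)" unfolding single_valued_def using *(2) by blast
  ultimately show ?thesis using T by auto
qed

lemma pseudogroup_partial_bijections: "pseudogroup (partial_bijections X)"
proof
  fix T assume T: "jointly_compatible (partial_bijections X) T"
  note U = Union_partial_bijections[OF T]
  show "\<exists>j. least (natural_order (partial_bijections X)) j (Upper (natural_order (partial_bijections X)) T)"
    using is_join_Union[OF U] partial_bijections.least_Upper_iff by blast
  fix f assume f: "f \<in> carrier (partial_bijections X)"
  \<comment> \<open>The unions of the translates are products of partial bijections, so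
    \<open>join_partial_bijections\<close> computes their joins.\<close>
  have "\<Union> T O f \<in> carrier (partial_bijections X)" "f O \<Union> T \<in> carrier (partial_bijections X)"
    using partial_bijections.mul_closed[OF U f] partial_bijections.mul_closed[OF f U] by auto
  moreover have "\<Union> T O f = \<Union> ((\<lambda>s. s O f) ` T)" "f O \<Union> T = \<Union> ((\<lambda>s. f O s) ` T)"
    by blast+
  ultimately show
    "f \<cdot>\<^bsub>partial_bijections X\<^esub> \<Squnion>\<^bsub>natural_order (partial_bijections X)\<^esub> T =
      \<Squnion>\<^bsub>natural_order (partial_bijections X)\<^esub> ((\<cdot>\<^bsub>partial_bijections X\<^esub>) f ` T)"
    "\<Squnion>\<^bsub>natural_order (partial_bijections X)\<^esub> T \<cdot>\<^bsub>partial_bijections X\<^esub> f =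
      \<Squnion>\<^bsub>natural_order (partial_bijections X)\<^esub> ((\<lambda>s. s \<cdot>\<^bsub>partial_bijections X\<^esub> f) ` T)"
    using join_partial_bijections[OF U] join_partial_bijections[of _ X]
    by (simp_all del: partial_bijections_simps(1) add: partial_bijections_simps(2))
qed

section \<open>Points from a faithful representation\<close>

lemma has_enough_points_if_representation:
  fixes A :: "'a magma" (structure) and X :: "'x set"
  assumes hom: "pseudogroup_hom A (partial_bijections X) \<phi>" and inj: "inj_on \<phi> (carrier A)"
  shows "has_enough_points TYPE('a set) (idempotent_order A)"
proof -
  interpret pseudogroup A using hom by (rule pseudogroup_hom.axioms(1))
  note hom_closed = pseudogroup_hom.hom_closed[OF hom]
    and hom_join = pseudogroup_hom.hom_join[OF hom]
  have hom_mul: "\<phi> (a \<cdot> b) = \<phi> b O \<phi> a" if "a \<in> carrier A" "b \<in> carrier A" for a b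
    using pseudogroup_hom.hom_mul[OF hom that] by simp
  have hom_E: "\<phi> e \<subseteq> Id_on X" if e: "e \<in> E" for e
  proof -
    have "\<phi> e \<in> idempotents (partial_bijections X)"
      using hom_mul[of e e] hom_closed[of e] e by (simp add: idempotents_def)
    then show ?thesis by (simp add: idempotents_partial_bijections)
  qed
  \<comment> \<open>The image of an idempotent is a partial identity, hence determined by its domain
    \<open>D e\<close>.\<close>
  define D where "D e = {x. (x, x) \<in> \<phi> e}" for e
  have phi_eq: "\<phi> e = Id_on (D e)" if "e \<in> E" for e
    using hom_E[OF that] by (auto simp: D_def)
  have D_mul: "D (e \<cdot> g) = D e \<inter> D g" if "e \<in> E" "g \<in> E" for e g
  proof -
    have "Id_on (D (e \<cdot> g)) = Id_on (D g) O Id_on (D e)"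
      using hom_mul[of e g] that by (simp add: phi_eq[symmetric] E_mul_closed E_carrier)
    then show ?thesis by (auto simp: set_eq_iff)
  qed
  have D_join: "D (\<Or> S) = \<Union> (D ` S)" if S: "S \<subseteq> E" for S
  proof -
    have "\<Union> (\<phi> ` S) \<subseteq> Id_on X" using hom_E S by blast
    then have "\<Union> (\<phi> ` S) \<in> idempotents (partial_bijections X)"
      by (simp add: idempotents_partial_bijections)
    then have "\<Union> (\<phi> ` S) \<in> carrier (partial_bijections X)"
      by (rule partial_bijections.E_carrier)
    then have "\<phi> (\<Or> S) = \<Union> (\<phi> ` S)"
      using hom_join[OF compatible_E[OF S]] join_partial_bijections by metis
    then show ?thesis by (auto simp: D_def)
  qed
  \<comment> \<open>Faithfulness enters here: equality of the domains of \<open>g \<cdot> e\<close>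
    and \<open>e\<close> gives equality of their images, hence of the idempotents.\<close>
  have D_le: "D e \<subseteq> D g \<longleftrightarrow> e \<preceq> g" if eg: "e \<in> E" "g \<in> E" for e g
  proof -
    have "D e \<subseteq> D g \<longleftrightarrow> D (g \<cdot> e) = D e" using D_mul[of g e] eg by auto
    also have "\<dots> \<longleftrightarrow> Id_on (D (g \<cdot> e)) = Id_on (D e)" by (metis Domain_Id_on)
    also have "\<dots> \<longleftrightarrow> \<phi> (g \<cdot> e) = \<phi> e"
      using eg phi_eq[of "g \<cdot> e"] phi_eq[of e] by (simp add: E_mul_closed)
    also have "\<dots> \<longleftrightarrow> g \<cdot> e = e"
      using eg by (intro inj_on_eq_iff[OF inj] mul_closed E_carrier)
    finally show ?thesis using eg by (simp add: E_below_iff)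
  qed
  \<comment> \<open>Each \<open>x\<close> is replaced by its filter. This identifies points lying in
    the same domains and puts the space on \<open>'a set\<close>, whatever the type of
    \<open>X\<close> is.\<close>
  define p where "p x = {e \<in> E. x \<in> D e}" for x
  define f where "f e = p ` D e" for e
  have p_in: "p x \<in> f e \<longleftrightarrow> x \<in> D e" if "e \<in> E" for x e
    using that by (auto simp: f_def p_def)
  \<comment> \<open>A direct image need not preserve intersections; this one does, because
    \<open>p x\<close> determines which domains contain \<open>x\<close>.\<close>
  have f_mul: "f (e \<cdot> g) = f e \<inter> f g" if "e \<in> E" "g \<in> E" for e g
  proof (intro equalityI subsetI)
    fix P assume "P \<in> f e \<inter> f g"
    then obtain x where "P = p x" "x \<in> D e" by (auto simp: f_def)
    with \<open>P \<in> f e \<inter> f g\<close> show "P \<in> f (e \<cdot> g)" using that by (simp add: p_in D_mul E_mul_closed)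
  qed (use that in \<open>auto simp: f_def D_mul\<close>)
  have f_join: "f (\<Or> S) = \<Union> (f ` S)" if "S \<subseteq> E" for S
    using D_join[OF that] by (auto simp: f_def)
  have f_le: "f e \<subseteq> f g \<longleftrightarrow> e \<preceq> g" if "e \<in> E" "g \<in> E" for e g
  proof -
    have "f e \<subseteq> f g \<longleftrightarrow> D e \<subseteq> D g"
      using p_in[OF that(2)] unfolding f_def by blast
    then show ?thesis using D_le[OF that] by simp
  qed
  define Z where "Z = topology (\<lambda>U. U \<in> f ` E)"
  have "istopology (\<lambda>U. U \<in> f ` E)"
    unfolding istopology_def
  proof (intro conjI allI impI)
    fix U V assume "U \<in> f ` E" "V \<in> f ` E"
    then show "U \<inter> V \<in> f ` E" using f_mul E_mul_closed by (auto simp: f_mul[symmetric])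
  next
    fix K assume K: "\<forall>U\<in>K. U \<in> f ` E"
    \<comment> \<open>Every member of \<open>K\<close> is some \<open>f e\<close>. Taking all
      idempotents with image in \<open>K\<close> yields the same union without choosing
      preimages.\<close>
    define S where "S = {e \<in> E. f e \<in> K}"
    have S: "S \<subseteq> E" by (auto simp: S_def)
    have "\<Union> K = f (\<Or> S)" using K unfolding f_join[OF S] by (auto simp: S_def)
    then show "\<Union> K \<in> f ` E" using join_E[OF S] by blast
  qed
  then have Z: "{U. openin Z U} = f ` E" unfolding Z_def by (simp add: topology_inverse')
  have "inj_on f E"
    using f_le below_antisym E_carrier by (intro inj_onI) (metis order_refl)
  then have "order_iso (idempotent_order A) (opens Z) f"
    unfolding order_iso_def order_emb_def bij_betw_def
    using f_le Z weak_partial_order_idempotent_order[OF inverse_semigroup_axioms] weak_partial_order_opens[of Z]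
    by (simp add: idempotent_order_def opens_def)
  then show ?thesis unfolding has_enough_points_def by blast
qed

section \<open>The representation on germs\<close>

context pseudogroup
begin

definition germ where
  "germ p a = {x \<in> carrier A. \<exists>e\<in>p. a \<cdot> e = x \<cdot> e}"

definition germs where
  "germs = {germ p a |p a. completely_prime_filter p \<and> a \<in> carrier A \<and> source a \<in> p}"

text \<open>Left multiplication, given as a set of pairs over all representatives; independence of
  the representative is shown in \<open>germ_action_iff\<close>. The condition on
  \<open>source (c \<cdot> a)\<close> already puts \<open>source a\<close> into \<open>p\<close>, by
  \<open>source_mul_below\<close>.\<close>

definition germ_action where
  "germ_action c =
    {(germ p a, germ p (c \<cdot> a)) |p a.
      completely_prime_filter p \<and> a \<in> carrier A \<and> source (c \<cdot> a) \<in> p}"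

section \<open>Sources, filters and equality of germs\<close>

lemma source_mul_idem:
  assumes "a \<in> carrier A" "e \<in> E"
  shows "source (a \<cdot> e) = source a \<cdot> e"
proof -
  have "source (a \<cdot> e) = e \<cdot> (source a \<cdot> e)"
    using assms by (simp add: mul_assoc closed inverse_mul inverse_idem)
  also have "\<dots> = source a \<cdot> (e \<cdot> e)"
    using assms by (intro E_commute_assoc) (simp_all add: closed source_E)
  finally show ?thesis using assms by (simp add: E_idem)
qed

text \<open>The case \<open>e = source c\<close> of \<open>idem_mul_eq\<close>. It cancels
  \<open>c\<close> up to a restriction of \<open>a\<close>, which will give injectivity of the
  action.\<close>

lemma idem_mul_eq_source:
  assumes "a \<in> carrier A" "c \<in> carrier A"
  shows "c\<^sup>\<star> \<cdot> (c \<cdot> a) = a \<cdot> source (c \<cdot> a)"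
  using idem_mul_eq[OF source_E[OF assms(2)] assms(1)] assms
  by (simp add: mul_assoc closed inverse_mul)

lemma source_mono:
  assumes "a \<preceq> b" "b \<in> carrier A"
  shows "source a \<preceq> source b"
  using below_source(1)[OF assms] below_carrier[OF assms] assms by (metis belowI source_E)

lemma source_mul_below:
  assumes "a \<in> carrier A" "c \<in> carrier A"
  shows "source (c \<cdot> a) \<preceq> source a"
proof -
  have "source a \<cdot> source (c \<cdot> a) = source (c \<cdot> a)"
    using assms by (simp add: mul_assoc closed inverse_mul inverse_assoc)
  then show ?thesis using assms by (simp add: E_below_iff source_E closed)
qed

lemma filter_below_mul:
  assumes "completely_prime_filter p" "e \<cdot> f \<in> p" "e \<in> E" "f \<in> E"
  shows "e \<in> p" "f \<in> p"
proof -
  show "e \<in> p" by (rule filter_up[OF assms(1,2) belowI[OF refl assms(4)] assms(3)])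
  have "e \<cdot> f \<preceq> f" unfolding E_commute[OF assms(3,4)] by (rule belowI[OF refl assms(3)])
  then show "f \<in> p" by (rule filter_up[OF assms(1,2) _ assms(4)])
qed

text \<open>Agreement on \<open>e\<close> equates \<open>source a \<cdot> e\<close> with
  \<open>source b \<cdot> e\<close>, which lies below \<open>source b\<close>.\<close>

lemma filter_source_cong:
  assumes p: "completely_prime_filter p" and ab: "a \<in> carrier A" "b \<in> carrier A"
    and e: "e \<in> p" "a \<cdot> e = b \<cdot> e" and a: "source a \<in> p"
  shows "source b \<in> p"
proof -
  have "e \<in> E" using filter_E[OF p] e by blast
  have "source a \<cdot> e \<in> p" by (rule filter_mul[OF p a e(1)])
  then have "source b \<cdot> e \<in> p"
    using \<open>e \<in> E\<close> ab e(2) by (simp add: source_mul_idem[symmetric])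
  then show ?thesis using filter_below_mul(1)[OF p] source_E ab \<open>e \<in> E\<close> by blast
qed

lemma germ_eqI:
  assumes p: "completely_prime_filter p" and ab: "a \<in> carrier A" "b \<in> carrier A"
    and e: "e \<in> p" "a \<cdot> e = b \<cdot> e"
  shows "germ p a = germ p b"
proof -
  have *: "germ p c \<subseteq> germ p d"
    if cd: "c \<in> carrier A" "d \<in> carrier A" "c \<cdot> e = d \<cdot> e" for c d
  proof
    fix x assume "x \<in> germ p c"
    then obtain f where f: "x \<in> carrier A" "f \<in> p" "c \<cdot> f = x \<cdot> f" by (auto simp: germ_def)
    have E: "e \<in> E" "f \<in> E" using filter_E[OF p] e f by blast+
    \<comment> \<open>Agreement is transitive: witnesses \<open>e\<close> and \<open>f\<close>
      combine to \<open>e \<cdot> f\<close>, which is again in \<open>p\<close>.\<close>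
    have "d \<cdot> (e \<cdot> f) = (c \<cdot> e) \<cdot> f" using cd E by (simp add: mul_assoc closed)
    also have "\<dots> = (c \<cdot> f) \<cdot> e" using cd(1) E by (simp add: mul_assoc closed E_commute)
    also have "\<dots> = x \<cdot> (e \<cdot> f)" unfolding f(3) using f(1) E by (simp add: mul_assoc closed E_commute)
    finally show "x \<in> germ p d" unfolding germ_def using f(1) filter_mul[OF p e(1) f(2)] by blast
  qed
  show ?thesis using *[OF ab e(2)] *[OF ab(2,1) e(2)[symmetric]] by blast
qed

text \<open>
  The base point of a germ can be recovered from the underlying subset of \<open>A\<close>. This is why
  germs need no explicit base point, and their carrier fits into \<open>'a set\<close>.
\<close>

lemma filter_eq_germ:
  assumes p: "completely_prime_filter p" and a: "a \<in> carrier A" "source a \<in> p"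
  shows "p = {e \<in> E. a \<cdot> e \<in> germ p a}"
proof (intro equalityI subsetI)
  fix e assume e: "e \<in> p"
  then have "e \<in> E" using filter_E[OF p] by blast
  then have "a \<cdot> e = (a \<cdot> e) \<cdot> e" "a \<cdot> e \<in> carrier A"
    using a by (simp_all add: mul_assoc closed E_idem)
  then show "e \<in> {e \<in> E. a \<cdot> e \<in> germ p a}" using e \<open>e \<in> E\<close> by (auto simp: germ_def)
next
  fix e assume "e \<in> {e \<in> E. a \<cdot> e \<in> germ p a}"
  then obtain f where e: "e \<in> E" and f: "f \<in> p" "a \<cdot> f = (a \<cdot> e) \<cdot> f" by (auto simp: germ_def)
  have fE: "f \<in> E" using filter_E[OF p] f by blast
  \<comment> \<open>Comparing sources on both sides of the agreement shows that
    \<open>source a \<cdot> f\<close>, an element of \<open>p\<close>, absorbs \<open>e\<close> and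
    so lies below it.\<close>
  have "source a \<cdot> f = source (a \<cdot> f)" using fE a by (simp add: source_mul_idem)
  also have "a \<cdot> f = a \<cdot> (e \<cdot> f)" using f(2) e fE a by (simp add: mul_assoc closed)
  also have "source (a \<cdot> (e \<cdot> f)) = source a \<cdot> (e \<cdot> f)" using e fE a by (simp add: source_mul_idem E_mul_closed)
  also have "\<dots> = e \<cdot> (source a \<cdot> f)" using e fE a by (intro E_commute_assoc) (auto simp: closed source_E)
  finally have "e \<cdot> (source a \<cdot> f) \<in> p" using filter_mul[OF p a(2) f(1)] by simp
  then show "e \<in> p" using filter_below_mul(1)[OF p] e fE a E_mul_closed source_E by blast
qed

text \<open>Since \<open>b\<close> lies in its own germ, it agrees with \<open>a\<close> on some
  element of \<open>p\<close>. Hence \<open>b\<close> represents the germ at \<open>p\<close> as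
  well, and \<open>filter_eq_germ\<close> for this one \<open>b\<close> returns both
  \<open>p\<close> and \<open>q\<close>.\<close>

lemma germ_eqD:
  assumes p: "completely_prime_filter p" and q: "completely_prime_filter q"
    and a: "a \<in> carrier A" "source a \<in> p" and b: "b \<in> carrier A" "source b \<in> q"
    and eq: "germ p a = germ q b"
  shows "p = q" "\<exists>e\<in>p. a \<cdot> e = b \<cdot> e"
proof -
  have "b \<in> germ q b" using b by (auto simp: germ_def)
  then show ex: "\<exists>e\<in>p. a \<cdot> e = b \<cdot> e" unfolding eq[symmetric] by (simp add: germ_def)
  then obtain e where e: "e \<in> p" "a \<cdot> e = b \<cdot> e" by blast
  have "source b \<in> p" by (rule filter_source_cong[OF p a(1) b(1) e a(2)])
  moreover have "germ p b = germ q b" using germ_eqI[OF p a(1) b(1) e] eq by simp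
  ultimately show "p = q"
    using filter_eq_germ[OF p b(1)] filter_eq_germ[OF q b(1)] b(2) by simp
qed

section \<open>The action on germs and its compatibility with products, joins and meets\<close>

lemma germ_actionE:
  assumes "(G, H) \<in> germ_action c" "c \<in> carrier A"
  obtains p a where "completely_prime_filter p" "a \<in> carrier A" "source a \<in> p"
    "source (c \<cdot> a) \<in> p" "G = germ p a" "H = germ p (c \<cdot> a)"
proof -
  obtain p a where *: "completely_prime_filter p" "a \<in> carrier A"
    "source (c \<cdot> a) \<in> p" "G = germ p a" "H = germ p (c \<cdot> a)"
    using assms(1) unfolding germ_action_def by blast
  have "source a \<in> p"
    using *(2) assms(2) by (intro filter_up[OF *(1,3)] source_mul_below source_E)
  with * that show thesis by blast
qed

text \<open>Evaluates the action at a representative of one's choice: any other one agrees with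
  \<open>a\<close> on an element of \<open>p\<close>, and left multiplication by \<open>c\<close>
  keeps the agreement.\<close>

lemma germ_action_iff:
  assumes p: "completely_prime_filter p" and a: "a \<in> carrier A" "source a \<in> p"
    and c: "c \<in> carrier A"
  shows "(germ p a, H) \<in> germ_action c \<longleftrightarrow> source (c \<cdot> a) \<in> p \<and> H = germ p (c \<cdot> a)"
proof
  assume "(germ p a, H) \<in> germ_action c"
  then obtain q b where q: "completely_prime_filter q" and b: "b \<in> carrier A" "source b \<in> q"
    and *: "source (c \<cdot> b) \<in> q" "germ p a = germ q b" "H = germ q (c \<cdot> b)"
    by (rule germ_actionE[OF _ c])
  have pq: "p = q" and "\<exists>e\<in>p. a \<cdot> e = b \<cdot> e" using germ_eqD[OF p q a b *(2)] by blast+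
  then obtain e where e: "e \<in> p" "a \<cdot> e = b \<cdot> e" by blast
  then have "e \<in> carrier A" using filter_E[OF p] E_carrier by blast
  then have ce: "c \<cdot> a \<cdot> e = c \<cdot> b \<cdot> e" using e a b c by (simp add: mul_assoc)
  show "source (c \<cdot> a) \<in> p \<and> H = germ p (c \<cdot> a)"
    using filter_source_cong[OF p _ _ e(1) ce[symmetric]] germ_eqI[OF p _ _ e(1) ce] a b c * pq
    by (simp add: closed)
qed (use assms in \<open>auto simp: germ_action_def\<close>)

lemma germ_action_closed:
  assumes c: "c \<in> carrier A"
  shows "germ_action c \<in> carrier (partial_bijections germs)"
  unfolding partial_bijections_simps
proof (intro conjI)
  show "germ_action c \<subseteq> germs \<times> germs"
    using c by (auto elim!: germ_actionE simp: germs_def intro: mul_closed)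
  show "single_valued (germ_action c)"
  proof (rule single_valuedI)
    fix G H H' assume "(G, H) \<in> germ_action c" and H': "(G, H') \<in> germ_action c"
    then obtain p a where p: "completely_prime_filter p" and a: "a \<in> carrier A" "source a \<in> p"
      and G: "G = germ p a" "H = germ p (c \<cdot> a)"
      using c by (auto elim: germ_actionE)
    then show "H = H'" using H' by (simp add: germ_action_iff c)
  qed
  have "G = G'" if GH: "(G, H) \<in> germ_action c" and GH': "(G', H) \<in> germ_action c" for G G' H
  proof -
    obtain p a where p: "completely_prime_filter p" and a: "a \<in> carrier A" "source a \<in> p"
      and G: "source (c \<cdot> a) \<in> p" "G = germ p a" "H = germ p (c \<cdot> a)"
      using GH c by (rule germ_actionE)
    obtain q b where q: "completely_prime_filter q" and b: "b \<in> carrier A" "source b \<in> q"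
      and G': "source (c \<cdot> b) \<in> q" "G' = germ q b" "H = germ q (c \<cdot> b)"
      using GH' c by (rule germ_actionE)
    have ca: "c \<cdot> a \<in> carrier A" "c \<cdot> b \<in> carrier A" using a b c by (auto simp: closed)
    have "germ p (c \<cdot> a) = germ q (c \<cdot> b)" using G(3) G'(3) by simp
    from germ_eqD[OF p q ca(1) G(1) ca(2) G'(1) this]
    obtain e where pq: "p = q" and e: "e \<in> p" "c \<cdot> a \<cdot> e = c \<cdot> b \<cdot> e" by blast
    have E: "e \<in> E" using filter_E[OF p] e by blast
    \<comment> \<open>Multiplying \<open>c \<cdot> a \<cdot> e = c \<cdot> b \<cdot> e\<close> by
      \<open>c\<^sup>\<star>\<close> removes \<open>c\<close> at the cost of restricting
      \<open>a\<close> to \<open>d\<close> and \<open>b\<close> to \<open>d'\<close>, both of which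
      lie in \<open>p\<close>.\<close>
    define d d' where d: "d = source (c \<cdot> a)" and d': "d' = source (c \<cdot> b)"
    have dp: "d \<in> p" "d' \<in> p" using G G' pq by (auto simp: d d')
    then have dE: "d \<in> E" "d' \<in> E" using filter_E[OF p] by blast+
    note s = mul_assoc closed a b c E dE
    have "(a \<cdot> d) \<cdot> e = c\<^sup>\<star> \<cdot> (c \<cdot> a \<cdot> e)"
      unfolding d idem_mul_eq_source[OF a(1) c, symmetric] by (simp add: s)
    also have "\<dots> = (b \<cdot> d') \<cdot> e"
      unfolding d' idem_mul_eq_source[OF b(1) c, symmetric] e(2) by (simp add: s)
    finally have w: "a \<cdot> (d \<cdot> e) = b \<cdot> (d' \<cdot> e)" by (simp add: s)
    define u v where u: "u = d \<cdot> e" and v: "v = d' \<cdot> e"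
    have uv: "u \<in> E" "v \<in> E" unfolding u v using dE E by (intro E_mul_closed; simp)+
    have w: "a \<cdot> u = b \<cdot> v" unfolding u v by (rule w)
    \<comment> \<open>The equation \<open>a \<cdot> u = b \<cdot> v\<close> has different
      idempotents on its two sides; on their product \<open>g\<close> both \<open>a\<close> and
      \<open>b\<close> restrict to that common element.\<close>
    define g where "g = u \<cdot> v"
    have "a \<cdot> g = a \<cdot> u \<cdot> v" using a uv by (simp add: g_def mul_assoc closed)
    also have "\<dots> = b \<cdot> v" unfolding w using b uv by (simp add: mul_assoc closed E_idem)
    finally have ag: "a \<cdot> g = b \<cdot> v" .
    have "b \<cdot> g = b \<cdot> v \<cdot> u" using b uv by (simp add: g_def mul_assoc closed E_commute)
    also have "\<dots> = a \<cdot> u" unfolding w[symmetric] using a uv by (simp add: mul_assoc closed E_idem)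
    finally have "a \<cdot> g = b \<cdot> g" using ag w by simp
    moreover have "g \<in> p" unfolding g_def u v using dp e by (intro filter_mul[OF p])
    ultimately show ?thesis using germ_eqI[OF p a(1) b(1)] G G' pq by simp
  qed
  then show "single_valued ((germ_action c)\<inverse>)" unfolding single_valued_converse_iff by blast
qed

lemma germ_action_mul:
  assumes c: "c \<in> carrier A" and d: "d \<in> carrier A"
  shows "germ_action (c \<cdot> d) = germ_action d O germ_action c"
proof (intro equalityI subrelI)
  fix G H assume "(G, H) \<in> germ_action (c \<cdot> d)"
  then obtain p a where p: "completely_prime_filter p" and a: "a \<in> carrier A" "source a \<in> p"
    and G: "source (c \<cdot> d \<cdot> a) \<in> p" "G = germ p a" "H = germ p (c \<cdot> d \<cdot> a)"
    by (rule germ_actionE) (use c d in \<open>simp add: closed\<close>)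
  have da: "d \<cdot> a \<in> carrier A" and cda: "c \<cdot> d \<cdot> a = c \<cdot> (d \<cdot> a)"
    using a c d by (auto simp: closed mul_assoc)
  have "source (d \<cdot> a) \<in> p"
    using G(1) unfolding cda by (rule filter_up[OF p]) (use da c in \<open>auto intro: source_mul_below source_E\<close>)
  then have "(G, germ p (d \<cdot> a)) \<in> germ_action d" "(germ p (d \<cdot> a), H) \<in> germ_action c"
    using G a c d da cda p by (simp_all add: germ_action_iff)
  then show "(G, H) \<in> germ_action d O germ_action c" by blast
next
  fix G H assume "(G, H) \<in> germ_action d O germ_action c"
  then obtain K where K: "(G, K) \<in> germ_action d" "(K, H) \<in> germ_action c" by blast
  obtain p a where p: "completely_prime_filter p" and a: "a \<in> carrier A" "source a \<in> p"
    and G: "source (d \<cdot> a) \<in> p" "G = germ p a" "K = germ p (d \<cdot> a)"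
    using K(1) d by (rule germ_actionE)
  have "source (c \<cdot> (d \<cdot> a)) \<in> p \<and> H = germ p (c \<cdot> (d \<cdot> a))"
    using K(2) G p a c d by (simp add: germ_action_iff closed)
  then show "(G, H) \<in> germ_action (c \<cdot> d)"
    using G p a c d by (simp add: germ_action_iff closed mul_assoc)
qed

lemma germ_action_unit: "germ_action (unit_of A) = Id_on germs"
proof -
  have u: "unit_of A \<in> carrier A" using unit_E E_carrier by blast
  show ?thesis
  proof (intro equalityI subrelI)
    fix G H assume "(G, H) \<in> germ_action (unit_of A)"
    then show "(G, H) \<in> Id_on germs"
      by (rule germ_actionE[OF _ u]) (auto simp: germs_def unit_mul_left)
  next
    fix G H assume "(G, H) \<in> Id_on germs"
    then show "(G, H) \<in> germ_action (unit_of A)"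
      by (auto simp: germs_def germ_action_iff u unit_mul_left)
  qed
qed

lemma germ_action_mono:
  assumes cd: "c \<preceq> d" and d: "d \<in> carrier A"
  shows "germ_action c \<subseteq> germ_action d"
proof (rule subrelI)
  have c: "c \<in> carrier A" using cd d by (rule below_carrier)
  fix G H assume "(G, H) \<in> germ_action c"
  then obtain p a where p: "completely_prime_filter p" and a: "a \<in> carrier A" "source a \<in> p"
    and G: "source (c \<cdot> a) \<in> p" "G = germ p a" "H = germ p (c \<cdot> a)"
    using c by (rule germ_actionE)
  have ca: "c \<cdot> a \<in> carrier A" "d \<cdot> a \<in> carrier A" using a c d by (auto simp: closed)
  have le: "c \<cdot> a \<preceq> d \<cdot> a" using cd d a by (intro below_mul_right)
  have "source (d \<cdot> a) \<in> p"
    using ca by (intro filter_up[OF p G(1) source_mono[OF le]] source_E)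
  \<comment> \<open>As \<open>c \<cdot> a\<close> is the restriction of \<open>d \<cdot> a\<close>
    to its own source, that source, an element of \<open>p\<close>, witnesses the equality of
    germs.\<close>
  moreover have "c \<cdot> a \<cdot> source (c \<cdot> a) = d \<cdot> a \<cdot> source (c \<cdot> a)"
    using below_source(3)[OF le ca(2)] inverse_assoc(1)[OF ca(1)] by simp
  then have "germ p (c \<cdot> a) = germ p (d \<cdot> a)" by (rule germ_eqI[OF p ca G(1)])
  ultimately show "(G, H) \<in> germ_action d" using G p a d by (simp add: germ_action_iff)
qed

lemma germ_action_join:
  assumes S: "jointly_compatible A S"
  shows "germ_action (\<Or> S) = \<Union> (germ_action ` S)"
proof
  note j = join_closed[OF S]
  have SA: "S \<subseteq> carrier A" using S by (simp add: jointly_compatible_def)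
  show "\<Union> (germ_action ` S) \<subseteq> germ_action (\<Or> S)"
    using germ_action_mono[OF join_upper[OF S] j] by blast
  show "germ_action (\<Or> S) \<subseteq> \<Union> (germ_action ` S)"
  proof (rule subrelI)
    fix G H assume GH: "(G, H) \<in> germ_action (\<Or> S)"
    then obtain p a where p: "completely_prime_filter p" and a: "a \<in> carrier A" "source a \<in> p"
      and G: "source ((\<Or> S) \<cdot> a) \<in> p" "G = germ p a"
      using j by (rule germ_actionE)
    \<comment> \<open>Complete primeness enters here: a join of sources in \<open>p\<close> has one
      of its members \<open>source (s \<cdot> a)\<close> in \<open>p\<close>. The value
      \<open>H\<close> is then forced, as the action of \<open>s\<close> is contained in that of the
      join.\<close>
    have "(\<lambda>s. source (s \<cdot> a)) ` S \<subseteq> E" using SA a by (auto intro!: source_E mul_closed)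
    from filter_prime[OF p this] G(1) obtain s where s: "s \<in> S" "source (s \<cdot> a) \<in> p"
      unfolding source_join_mul[OF S a(1)] by blast
    then have *: "(G, germ p (s \<cdot> a)) \<in> germ_action s" using SA p a G by (auto simp: germ_action_iff)
    then have "(G, germ p (s \<cdot> a)) \<in> germ_action (\<Or> S)"
      using germ_action_mono[OF join_upper[OF S s(1)] j] by blast
    then have "H = germ p (s \<cdot> a)" using GH p a j G by (simp add: germ_action_iff)
    then show "(G, H) \<in> \<Union> (germ_action ` S)" using * s by blast
  qed
qed

lemma germ_action_meet:
  assumes c: "c \<in> carrier A" and d: "d \<in> carrier A"
  shows "germ_action (c \<sqinter>\<^bsub>natural_order A\<^esub> d) = germ_action c \<inter> germ_action d"
proof
  note m = meet_below[OF c d]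
  have mA: "c \<sqinter>\<^bsub>natural_order A\<^esub> d \<in> carrier A" by (rule below_carrier[OF m(1) c])
  show "germ_action (c \<sqinter>\<^bsub>natural_order A\<^esub> d) \<subseteq> germ_action c \<inter> germ_action d"
    using germ_action_mono[OF m(1) c] germ_action_mono[OF m(2) d] by blast
  show "germ_action c \<inter> germ_action d \<subseteq> germ_action (c \<sqinter>\<^bsub>natural_order A\<^esub> d)"
  proof (rule subrelI)
    fix G H assume GH: "(G, H) \<in> germ_action c \<inter> germ_action d"
    then have "(G, H) \<in> germ_action c" by simp
    then obtain p a where p: "completely_prime_filter p" and a: "a \<in> carrier A" "source a \<in> p"
      and G: "source (c \<cdot> a) \<in> p" "G = germ p a" "H = germ p (c \<cdot> a)"
      using c by (rule germ_actionE)
    have G': "source (d \<cdot> a) \<in> p" "H = germ p (d \<cdot> a)"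
      using GH G p a d by (simp_all add: germ_action_iff)
    have ca: "c \<cdot> a \<in> carrier A" "d \<cdot> a \<in> carrier A" using a c d by (auto simp: closed)
    obtain e where e: "e \<in> p" "c \<cdot> a \<cdot> e = d \<cdot> a \<cdot> e"
      using germ_eqD(2)[OF p p ca(1) G(1) ca(2) G'(1)] G(3) G'(2) by auto
    have E: "e \<in> E" using filter_E[OF p] e by blast
    \<comment> \<open>The witness \<open>e\<close> restricts the source of \<open>a\<close>, while
      \<open>c\<close> and \<open>d\<close> act on its range. Conjugation by \<open>a\<close>
      transports \<open>e\<close> there, and \<open>c \<cdot> h = d \<cdot> h\<close> becomes a
      common lower bound of \<open>c\<close> and \<open>d\<close>.\<close>
    define h where "h = a \<cdot> (e \<cdot> a\<^sup>\<star>)"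
    have h: "h \<in> E" using conj_E[of e "a\<^sup>\<star>"] E a by (simp add: h_def inverse_inverse closed)
    have "c \<cdot> h = (c \<cdot> a \<cdot> e) \<cdot> a\<^sup>\<star>" using E a c by (simp add: h_def mul_assoc closed)
    also have "\<dots> = d \<cdot> h" unfolding e(2) using E a d by (simp add: h_def mul_assoc closed)
    finally have ch: "c \<cdot> h = d \<cdot> h" .
    have le: "c \<cdot> h \<preceq> c \<sqinter>\<^bsub>natural_order A\<^esub> d"
      by (rule meet_greatest[OF c d belowI[OF refl h] belowI[OF ch h]])
    have hA: "h \<in> carrier A" "c \<cdot> h \<in> carrier A" "c \<cdot> h \<cdot> a \<in> carrier A"
      using h c a by (auto simp: closed)
    \<comment> \<open>On \<open>e\<close> the factor \<open>h\<close> has no effect on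
      \<open>a\<close>, so \<open>c \<cdot> h\<close> acts on this germ exactly as \<open>c\<close>
      does.\<close>
    have "h \<cdot> a \<cdot> e = a \<cdot> (e \<cdot> (source a \<cdot> e))" using E a by (simp add: h_def mul_assoc closed)
    also have "\<dots> = a \<cdot> (source a \<cdot> (e \<cdot> e))"
      using E a by (subst E_commute_assoc) (auto simp: closed source_E)
    also have "\<dots> = a \<cdot> e" using E a by (simp add: mul_assoc closed E_idem inverse_assoc)
    finally have "c \<cdot> a \<cdot> e = c \<cdot> h \<cdot> a \<cdot> e" using E a c h by (simp add: mul_assoc closed)
    note eq = ca(1) hA(3) e(1) this
    have "(G, H) \<in> germ_action (c \<cdot> h)"
      using germ_eqI[OF p eq] filter_source_cong[OF p eq G(1)] G p a hA
      by (simp add: germ_action_iff)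
    then show "(G, H) \<in> germ_action (c \<sqinter>\<^bsub>natural_order A\<^esub> d)"
      using germ_action_mono[OF le mA] by blast
  qed
qed

section \<open>The germ action as a faithful homomorphism\<close>

lemma pseudogroup_hom_germ_action: "pseudogroup_hom A (partial_bijections germs) germ_action"
proof -
  interpret B: pseudogroup "partial_bijections germs" by (rule pseudogroup_partial_bijections)
  show ?thesis
  proof
    show "germ_action a \<in> carrier (partial_bijections germs)" if "a \<in> carrier A" for a
      using that by (rule germ_action_closed)
    show "germ_action (a \<cdot> b) = germ_action a \<cdot>\<^bsub>partial_bijections germs\<^esub> germ_action b"
      if "a \<in> carrier A" "b \<in> carrier A" for a b
      using germ_action_mul[OF that] by simp
    have "unit_of (partial_bijections germs) = \<Union> {e. e \<subseteq> Id_on germs}"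
      unfolding unit_of_def idempotents_partial_bijections
    proof (rule join_partial_bijections)
      have "\<Union> {e. e \<subseteq> Id_on germs} = Id_on germs" by blast
      moreover have "Id_on germs \<in> idempotents (partial_bijections germs)"
        by (simp add: idempotents_partial_bijections)
      ultimately show "\<Union> {e. e \<subseteq> Id_on germs} \<in> carrier (partial_bijections germs)"
        by (metis partial_bijections.E_carrier)
    qed
    then show "germ_action (unit_of A) = unit_of (partial_bijections germs)"
      unfolding germ_action_unit by blast
    show "germ_action (\<Or> S) = \<Squnion>\<^bsub>natural_order (partial_bijections germs)\<^esub> (germ_action ` S)"
      if S: "jointly_compatible A S" for S
      using germ_action_closed[OF join_closed[OF S]] join_partial_bijections
      unfolding germ_action_join[OF S] by metis
    show "germ_action (a \<sqinter>\<^bsub>natural_order A\<^esub> b) =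
        germ_action a \<sqinter>\<^bsub>natural_order (partial_bijections germs)\<^esub> germ_action b"
      if ab: "a \<in> carrier A" "b \<in> carrier A" for a b
    proof -
      note cl = germ_action_closed[OF ab(1)] germ_action_closed[OF ab(2)]
      have cl': "germ_action a \<inter> germ_action b \<in> carrier (partial_bijections germs)"
        by (rule partial_bijections_subset[OF _ cl(1)]) blast
      have "germ_action a \<sqinter>\<^bsub>natural_order (partial_bijections germs)\<^esub> germ_action b
          = germ_action a \<inter> germ_action b"
        using cl cl' by (intro partial_bijections.meet_eqI) (simp_all only: partial_bijections_below_iff Int_lower1 Int_lower2 Int_greatest)
      then show ?thesis using germ_action_meet[OF ab] by simp
    qed
  qed
qed

text \<open>Idempotents are told apart by the filters, comparable elements by their sources, and
  arbitrary elements by comparing each with their meet.\<close>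

lemma inj_germ_action:
  assumes sep: "\<And>e g. e \<in> E \<Longrightarrow> g \<in> E \<Longrightarrow>
    (\<And>p. completely_prime_filter p \<Longrightarrow> e \<in> p \<longleftrightarrow> g \<in> p) \<Longrightarrow> e = g"
  shows "inj_on germ_action (carrier A)"
proof -
  have sub: "g \<in> p"
    if "e \<in> E" "g \<in> E" "germ_action e = germ_action g" and p: "completely_prime_filter p" "e \<in> p"
    for e g p
  proof -
    have "(germ p e, germ p e) \<in> germ_action e"
      using that(1) p by (simp add: germ_action_iff E_carrier source_idem E_idem)
    then have "(germ p e, germ p e) \<in> germ_action g" using that(3) by simp
    then have "source (g \<cdot> e) \<in> p"
      using that(1,2) p by (simp add: germ_action_iff E_carrier source_idem)
    then have "g \<cdot> e \<in> p" using that by (simp add: source_idem E_mul_closed)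
    then show ?thesis using filter_below_mul(1) that by blast
  qed
  have idem: "e = g" if "e \<in> E" "g \<in> E" "germ_action e = germ_action g" for e g
    by (rule sep[OF that(1,2)]) (use sub that in metis)
  have source: "germ_action (source a) = germ_action a O (germ_action a)\<inverse>" if a: "a \<in> carrier A" for a
  proof -
    \<comment> \<open>The action of \<open>a\<^sup>\<star>\<close> satisfies both regularity
      identities, so it is the converse of the action of \<open>a\<close>. The action of
      \<open>source a\<close> is therefore determined by that of \<open>a\<close>.\<close>
    have *: "germ_action (a\<^sup>\<star>) = inverse_of (partial_bijections germs) (germ_action a)"
      using a germ_action_closed germ_action_mul[of a "a\<^sup>\<star>", symmetric] germ_action_mul[of "a\<^sup>\<star>" a, symmetric]
        germ_action_mul[of "a \<cdot> a\<^sup>\<star>" a, symmetric] germ_action_mul[of "a\<^sup>\<star> \<cdot> a" "a\<^sup>\<star>", symmetric]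
      by (intro partial_bijections.inverse_eqI[symmetric])
        (simp_all only: closed partial_bijections_simps(2) inverse)
    show ?thesis
      unfolding germ_action_mul[OF inverse_closed[OF a] a] *
      by (simp only: inverse_of_partial_bijections[OF germ_action_closed[OF a]])
  qed
  have below: "a = b" if ab: "a \<preceq> b" "b \<in> carrier A" "germ_action a = germ_action b" for a b
  proof -
    have a: "a \<in> carrier A" using ab(1,2) by (rule below_carrier)
    have "source a = source b"
      using idem source_E a ab(2) source[OF a] source[OF ab(2)] ab(3) by simp
    then show ?thesis using below_source(3)[OF ab(1,2)] inverse_assoc(1)[OF ab(2)] by simp
  qed
  show ?thesis
  proof (rule inj_onI)
    fix a b assume ab: "a \<in> carrier A" "b \<in> carrier A" "germ_action a = germ_action b"
    have "germ_action (a \<sqinter>\<^bsub>natural_order A\<^esub> b) = germ_action a"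
      using germ_action_meet[OF ab(1,2)] ab(3) by simp
    then have "a \<sqinter>\<^bsub>natural_order A\<^esub> b = a" "a \<sqinter>\<^bsub>natural_order A\<^esub> b = b"
      using below meet_below[OF ab(1,2)] ab by auto
    then show "a = b" by simp
  qed
qed

end

lemma representation_if_has_enough_points:
  fixes A :: "'a magma"
  assumes "pseudogroup A" "has_enough_points TYPE('z) (idempotent_order A)"
  shows "\<exists>(X :: 'a set set) \<phi>. pseudogroup_hom A (partial_bijections X) \<phi> \<and> inj_on \<phi> (carrier A)"
  using pseudogroup.pseudogroup_hom_germ_action[OF assms(1)]
    pseudogroup.inj_germ_action[OF assms(1)] has_enough_points_separating[OF assms]
  by blast

text \<open>The first conjunct is the equivalence at fixed types: filters of idempotents and germs
  are both of type \<open>'a set\<close>. The other two leave the type of the elements of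
  \<open>X\<close> and that of the points arbitrary, so the equivalence does not depend on this
  choice.\<close>

theorem theorem1p1:
  fixes A :: "'a magma"
  assumes "pseudogroup A"
  shows
    "((\<exists>(X :: 'a set set) \<phi>. pseudogroup_hom A (partial_bijections X) \<phi> \<and> inj_on \<phi> (carrier A))
        \<longleftrightarrow> has_enough_points TYPE('a set) (idempotent_order A))
   \<and> ((\<exists>(X :: 'x set) \<phi>. pseudogroup_hom A (partial_bijections X) \<phi> \<and> inj_on \<phi> (carrier A))
        \<longrightarrow> has_enough_points TYPE('a set) (idempotent_order A))
   \<and> (has_enough_points TYPE('z) (idempotent_order A)
        \<longrightarrow> (\<exists>(X :: 'a set set) \<phi>. pseudogroup_hom A (partial_bijections X) \<phi> \<and> inj_on \<phi> (carrier A)))"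
  by (intro conjI iffI impI; (elim exE conjE)?)
    (rule has_enough_points_if_representation representation_if_has_enough_points[OF assms];
      assumption)+

end
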